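(* Let $D_{gi},T_{si},T_{mi},K_i$ be positive real numbers such that $$4T_{si}T_{mi}^{-1}>1,\qquad D_{gi}T_{si}T_{mi}^{-1}>1,$$ and $$1-\frac{T_{mi}}{T_{si}}-\sqrt{\alpha_i}<K_i^{-1}<1-\frac{T_{mi}}{T_{si}}+\sqrt{\alpha_i},\qquad\text{where}\quad \alpha_i=T_{mi}^2T_{si}^{-2}(4T_{si}T_{mi}^{-1}-1)(D_{gi}T_{si}T_{mi}^{-1}-1).$$ Then the symmetric matrix $$W_i=\begin{bmatrix}-D_{gi}&-\tfrac12K_i^{-1}-\tfrac12&-\tfrac12K_i^{-1}+\tfrac12\\ -\tfrac12K_i^{-1}-\tfrac12&-T_{si}T_{mi}^{-1}&-\tfrac12\\ -\tfrac12K_i^{-1}+\tfrac12&-\tfrac12&-1\end{bmatrix}$$ is negative definite, $W_i<\boldsymbol 0$.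
   Context: $D_{gi}$ is the damping constant of a generator, $T_{si}$ and $T_{mi}$ are the governor and turbine time constants, and $K_i$ is the droop constant; all are positive. *)

theory Defs
  imports "HOL-Analysis.Analysis"
begin

definition negative_definite :: "real^'n^'n \<Rightarrow> bool" where
  "negative_definite A \<longleftrightarrow> transpose A = A \<and> (\<forall>x. x \<noteq> 0 \<longrightarrow> x \<bullet> (A *v x) < 0)"

definition W_matrix :: "real \<Rightarrow> real \<Rightarrow> real \<Rightarrow> real \<Rightarrow> real^3^3" where
  "W_matrix Dg Ts Tm K = vector
    [vector [- Dg, - (1/2) * inverse K - 1/2, - (1/2) * inverse K + 1/2],
     vector [- (1/2) * inverse K - 1/2, - Ts * inverse Tm, - (1/2)],
     vector [- (1/2) * inverse K + 1/2, - (1/2), - 1]]"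

definition alpha_coeff :: "real \<Rightarrow> real \<Rightarrow> real \<Rightarrow> real" where
  "alpha_coeff Dg Ts Tm =
    Tm^2 * Ts powi (-2) * (4 * Ts * inverse Tm - 1) * (Dg * Ts * inverse Tm - 1)"

end

theory Submission
  imports Defs
begin

text \<open>Put \<open>t = Ts / Tm\<close> and \<open>k = 1 / K\<close>. The two bounds on \<open>k\<close> say exactly that
  \<open>(t * (k - 1) + 1)\<^sup>2 < (4 * t - 1) * (Dg * t - 1)\<close>, which after cancelling a factor \<open>t\<close> is positivity
  of the determinant of \<open>- W\<close>. Completing the square twice, eliminating the third and then the
  second coordinate, gives pivots \<open>1\<close>, \<open>4 * t - 1\<close> and a positive multiple of this determinant.\<close>

lemma quadratic_form_pos:
  fixes D t k a b c :: real
  assumes t: "4 * t > 1"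
    and det: "D * (4 * t - 1) - 2 * k - 2 - t * (k - 1)\<^sup>2 > 0"
    and nz: "a \<noteq> 0 \<or> b \<noteq> 0 \<or> c \<noteq> 0"
  shows "D * a\<^sup>2 + t * b\<^sup>2 + c\<^sup>2 + (k + 1) * a * b + (k - 1) * a * c + b * c > 0"
    (is "?q > 0")
proof -
  \<comment> \<open>\<open>d\<close> is four times the determinant of the symmetric matrix of the
    form \<open>?q\<close>.\<close>
  define d where "d = D * (4 * t - 1) - 2 * k - 2 - t * (k - 1)\<^sup>2"
  \<comment> \<open>The factor \<open>4\<close> clears the halves when \<open>c\<close> is
    eliminated, and \<open>4 * t - 1\<close> clears the denominator when \<open>b\<close> is. The
    leftover coefficient of \<open>a\<^sup>2\<close> is \<open>4 * d\<close>.\<close>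
  have squares: "4 * (4 * t - 1) * ?q = (4 * t - 1) * (2 * c + (k - 1) * a + b)\<^sup>2
      + ((4 * t - 1) * b + (k + 3) * a)\<^sup>2 + 4 * d * a\<^sup>2"
    unfolding d_def by algebra
  have d: "d > 0" using det by (simp add: d_def)
  have "(4 * t - 1) * (2 * c + (k - 1) * a + b)\<^sup>2
      + ((4 * t - 1) * b + (k + 3) * a)\<^sup>2 + 4 * d * a\<^sup>2 > 0"
  \<comment> \<open>The three linear forms are triangular: the first nonzero coordinate in the order
    \<open>a\<close>, \<open>b\<close>, \<open>c\<close> survives alone in one of the squares and
    makes that term positive.\<close>
  proof (cases "a = 0")
    case False
    then have "4 * d * a\<^sup>2 > 0" using d by simp
    moreover have "(4 * t - 1) * (2 * c + (k - 1) * a + b)\<^sup>2 \<ge> 0" using t by simp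
    moreover have "((4 * t - 1) * b + (k + 3) * a)\<^sup>2 \<ge> 0" by simp
    ultimately show ?thesis by linarith
  next
    case a: True
    show ?thesis
    proof (cases "b = 0")
      case False
      then have "((4 * t - 1) * b)\<^sup>2 > 0" using t by simp
      moreover have "(4 * t - 1) * (2 * c + b)\<^sup>2 \<ge> 0" using t by simp
      ultimately have "(4 * t - 1) * (2 * c + b)\<^sup>2 + ((4 * t - 1) * b)\<^sup>2 > 0"
        by linarith
      then show ?thesis using a by simp
    next
      case True
      then show ?thesis using a nz t by simp
    qed
  qed
  then have "(4 * (4 * t - 1)) * ?q > 0" using squares by simp
  then show ?thesis using t by (simp add: zero_less_mult_iff)
qed

text \<open>The prefactor of \<open>alpha_coeff\<close> is the inverse square of
  \<open>Ts / Tm\<close>, so this scaling removes it and turns the squared bound on \<open>k\<close>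
  into a polynomial one.\<close>

lemma alpha_coeff_eq:
  assumes "Ts > 0" "Tm > 0"
  shows "(Ts / Tm)\<^sup>2 * alpha_coeff Dg Ts Tm = (4 * (Ts / Tm) - 1) * (Dg * (Ts / Tm) - 1)"
proof -
  have "(Ts / Tm)\<^sup>2 * (Tm\<^sup>2 * Ts powi (-2)) = 1"
    using assms by (simp add: power_int_minus power_divide)
  then have "(Ts / Tm)\<^sup>2 * (Tm\<^sup>2 * Ts powi (-2) * p * q) = p * q" for p q
    by (metis mult.assoc mult_1)
  then show ?thesis
    unfolding alpha_coeff_def by (simp only: divide_inverse mult.assoc)
qed

lemma det_pos:
  fixes D Ts Tm k :: real
  assumes "Ts > 0" "Tm > 0"
    and lo: "1 - Tm / Ts - sqrt (alpha_coeff D Ts Tm) < k"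
    and hi: "k < 1 - Tm / Ts + sqrt (alpha_coeff D Ts Tm)"
  shows "D * (4 * (Ts / Tm) - 1) - 2 * k - 2 - (Ts / Tm) * (k - 1)\<^sup>2 > 0"
proof -
  define t where "t = Ts / Tm"
  have t: "t > 0" using assms by (simp add: t_def)
  have "\<bar>k - 1 + Tm / Ts\<bar> < sqrt (alpha_coeff D Ts Tm)" using lo hi by linarith
  \<comment> \<open>The absolute value is the root of the square, and \<open>sqrt\<close> is
    strictly increasing on all reals, so the sign of \<open>alpha_coeff\<close> never has to be
    discussed.\<close>
  then have "(k - 1 + Tm / Ts)\<^sup>2 < alpha_coeff D Ts Tm"
    using real_sqrt_less_iff[of "(k - 1 + Tm / Ts)\<^sup>2"] by simp
  then have "t\<^sup>2 * (k - 1 + Tm / Ts)\<^sup>2 < t\<^sup>2 * alpha_coeff D Ts Tm"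
    using t by (intro mult_strict_left_mono) simp_all
  then have "(t * (k - 1 + Tm / Ts))\<^sup>2 < (4 * t - 1) * (D * t - 1)"
    using alpha_coeff_eq[OF assms(1,2), of D] by (simp only: t_def power_mult_distrib)
  moreover have "t * (k - 1 + Tm / Ts) = t * (k - 1) + 1"
    using assms by (simp add: t_def field_simps)
  ultimately have "(t * (k - 1) + 1)\<^sup>2 < (4 * t - 1) * (D * t - 1)"
    by simp
  \<comment> \<open>The constant terms of both products are 1 and cancel, which lets a factor
    \<open>t\<close> split off.\<close>
  moreover have "(4 * t - 1) * (D * t - 1) - (t * (k - 1) + 1)\<^sup>2
      = t * (D * (4 * t - 1) - 2 * k - 2 - t * (k - 1)\<^sup>2)"
    by algebra
  ultimately have "t * (D * (4 * t - 1) - 2 * k - 2 - t * (k - 1)\<^sup>2) > 0" by linarith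
  then show ?thesis using t unfolding t_def by (rule zero_less_mult_pos)
qed

lemma transpose_W_matrix: "transpose (W_matrix Dg Ts Tm K) = W_matrix Dg Ts Tm K"
  by (simp add: vec_eq_iff transpose_def W_matrix_def forall_3)

lemma inner_W_matrix:
  "x \<bullet> (W_matrix Dg Ts Tm K *v x) =
    - (Dg * (x$1)\<^sup>2 + (Ts / Tm) * (x$2)\<^sup>2 + (x$3)\<^sup>2 + (inverse K + 1) * x$1 * x$2
       + (inverse K - 1) * x$1 * x$3 + x$2 * x$3)"
proof -
  have "W_matrix Dg Ts Tm K *v x = vector
     [- Dg * x$1 + (- (1/2) * inverse K - 1/2) * x$2 + (- (1/2) * inverse K + 1/2) * x$3,
      (- (1/2) * inverse K - 1/2) * x$1 + (- Ts * inverse Tm) * x$2 + (- (1/2)) * x$3,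
      (- (1/2) * inverse K + 1/2) * x$1 + (- (1/2)) * x$2 + (- 1) * x$3]"
    by (simp only: vec_eq_iff forall_3 matrix_vector_mult_def vec_lambda_beta sum_3
        W_matrix_def vector_3 simp_thms)
  \<comment> \<open>With \<open>m\<close> standing for \<open>inverse Tm\<close> this is a
    polynomial identity; each off-diagonal entry occurs twice, which absorbs the halves.\<close>
  moreover have "a * (- D * a + (- (1/2) * k - 1/2) * b + (- (1/2) * k + 1/2) * c)
      + b * ((- (1/2) * k - 1/2) * a + (- Ts * m) * b + (- (1/2)) * c)
      + c * ((- (1/2) * k + 1/2) * a + (- (1/2)) * b + (- 1) * c)
      = - (D * a\<^sup>2 + (Ts * m) * b\<^sup>2 + c\<^sup>2 + (k + 1) * a * b + (k - 1) * a * c + b * c)"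
    for a b c D k m :: real
    by (simp add: field_simps power2_eq_square)
  ultimately show ?thesis
    by (simp only: inner_vec_def sum_3 inner_real_def vector_3 divide_inverse[of Ts Tm])
qed

theorem lemma7:
  fixes Dg Ts Tm K :: real
  assumes "Dg > 0" and "Ts > 0" and "Tm > 0" and "K > 0"
    and "4 * Ts * inverse Tm > 1"
    and "Dg * Ts * inverse Tm > 1"
    and "1 - Tm / Ts - sqrt (alpha_coeff Dg Ts Tm) < inverse K"
    and "inverse K < 1 - Tm / Ts + sqrt (alpha_coeff Dg Ts Tm)"
  shows "negative_definite (W_matrix Dg Ts Tm K)"
  unfolding negative_definite_def
proof (intro conjI allI impI transpose_W_matrix)
  fix x :: "real^3"
  assume "x \<noteq> 0"
  then have "x$1 \<noteq> 0 \<or> x$2 \<noteq> 0 \<or> x$3 \<noteq> 0" by (simp add: vec_eq_iff forall_3)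
  moreover have "4 * (Ts / Tm) > 1" using assms(5) by (simp add: divide_inverse mult.assoc)
  ultimately show "x \<bullet> (W_matrix Dg Ts Tm K *v x) < 0"
    unfolding inner_W_matrix neg_less_0_iff_less
    by (intro quadratic_form_pos det_pos[OF assms(2,3,7,8)])
qed

end
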